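(* Let $m,s\in\mathbb{N}$ with $m\le s$, and let $\{u_1,\ldots,u_m\}$ be a partition of $[1:s]=\{1,\ldots,s\}$ into nonempty pairwise disjoint subsets with union $[1:s]$. Let $F$ be a linear space of real-valued functions on a domain $D\subseteq\mathbb{R}^s$ and let $P_1,\ldots,P_s$ be commuting projections on $F$ as described in the context. Then a function $f\in F$ is separable with respect to $\boldsymbol{x}_{u_1},\ldots,\boldsymbol{x}_{u_m}$ if and only if \[ \left(\prod_{j=1}^{m}\left(I-P_{-u_j}\right)\right)(f)=0 . \]
   Context: Notation: $\boldsymbol{x}=(x_1,\ldots,x_s)$; for $u\subseteq[1:s]$, $\boldsymbol{x}_u=(x_j)_{j\in u}$ and $-u=[1:s]\setminus u$. Setting: $F$ is a linear space of real-valued functions defined on $D\subseteq\mathbb{R}^s$. $\{P_j: j=1,\ldots,s\}$ is a set of commuting projections on $F$ such that, for every $f\in F$, $P_j(f)$ does not depend on $x_j$, and $P_j(f)=f$ whenever $f$ does not depend on $x_j$. Put $P_u=\prod_{j\in u}P_j$ for $\emptyset\ne u\subseteq[1:s]$, and $P_\emptyset=I$ (the identity operator). For every $u\subseteq[1:s]$ and $f\in F$, the function $P_u(f)$ depends only on $\boldsymbol{x}_{-u}$ (in particular $P_{[1:s]}(f)$ is a constant). Separability: $f$ is separable with respect to $\boldsymbol{x}_{u_1},\ldots,\boldsymbol{x}_{u_m}$ if there exist functions $g_1,\ldots,g_m$ such that $f(\boldsymbol{x})=\sum_{j=1}^m g_j(\boldsymbol{x}_{u_j})$ holds for any $\boldsymbol{x}\in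 D$.
   Formalization: Separability is taken with summands g_j that belong to F as functions on D; with arbitrary g_j the claim fails, e.g. D=R^2, F=span{1, x1+x2}, P_1=P_2 sending 1 to 1 and x1+x2 to 0, f=x1+x2. *)

theory Defs
  imports Complex_Main "HOL-Library.FuncSet" "HOL-Library.Disjoint_Sets"
begin

text \<open>
  Points of \<open>\<real>\<^sup>s\<close> are elements of \<open>{1..s} \<rightarrow>\<^sub>E UNIV\<close>, so that \<open>restrict x u\<close> is the
  subvector of \<open>x\<close> with coordinates in \<open>u\<close>. A real-valued function on \<open>D\<close> is represented by
  the total function extending it by zero outside \<open>D\<close>; hence equality of functions on \<open>D\<close> is
  equality in HOL, and the vector space operations are pointwise.
\<close>

type_synonym point = "nat \<Rightarrow> real"

text \<open>
  Composition of the operators \<open>Q i\<close>, \<open>i \<in> A\<close>, for finite \<open>A\<close>, in increasing order of the index;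
  it is the identity for \<open>A = {}\<close>. The order is immaterial for the families used below, since
  they commute on the function space.
\<close>

definition op_prod :: "('i::linorder \<Rightarrow> 'a \<Rightarrow> 'a) \<Rightarrow> 'i set \<Rightarrow> 'a \<Rightarrow> 'a" where
  "op_prod Q A = foldr Q (sorted_list_of_set A)"

definition depends_only_on :: "point set \<Rightarrow> nat set \<Rightarrow> (point \<Rightarrow> real) \<Rightarrow> bool" where
  "depends_only_on D v f \<longleftrightarrow>
     (\<forall>x\<in>D. \<forall>y\<in>D. restrict x v = restrict y v \<longrightarrow> f x = f y)"

definition function_space :: "point set \<Rightarrow> (point \<Rightarrow> real) set \<Rightarrow> bool" where
  "function_space D F \<longleftrightarrow>
     (\<forall>f\<in>F. \<forall>x. x \<notin> D \<longrightarrow> f x = 0) \<and>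
     (\<lambda>x. 0) \<in> F \<and>
     (\<forall>f\<in>F. \<forall>g\<in>F. (\<lambda>x. f x + g x) \<in> F) \<and>
     (\<forall>c. \<forall>f\<in>F. (\<lambda>x. c * f x) \<in> F)"

definition projection_on ::
    "(point \<Rightarrow> real) set \<Rightarrow> ((point \<Rightarrow> real) \<Rightarrow> (point \<Rightarrow> real)) \<Rightarrow> bool" where
  "projection_on F Q \<longleftrightarrow>
     (\<forall>f\<in>F. Q f \<in> F) \<and>
     (\<forall>f\<in>F. \<forall>g\<in>F. Q (\<lambda>x. f x + g x) = (\<lambda>x. Q f x + Q g x)) \<and>
     (\<forall>c. \<forall>f\<in>F. Q (\<lambda>x. c * f x) = (\<lambda>x. c * Q f x)) \<and>
     (\<forall>f\<in>F. Q (Q f) = Q f)"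

text \<open>
  The last assumption follows from the others when \<open>D\<close> is a product of subsets of
  \<open>\<real>\<close>, but not for arbitrary \<open>D\<close>: if any two points of \<open>D\<close> differ in at least two
  coordinates, then every function on \<open>D\<close> satisfies
  \<open>depends_only_on D ({1..s} - {j})\<close> for each \<open>j\<close>, so every \<open>P j\<close> is the identity on \<open>F\<close>.
\<close>

locale commuting_projections =
  fixes s :: nat
    and D :: "point set"
    and F :: "(point \<Rightarrow> real) set"
    and P :: "nat \<Rightarrow> (point \<Rightarrow> real) \<Rightarrow> (point \<Rightarrow> real)"
  assumes domain: "D \<subseteq> ({1..s} \<rightarrow>\<^sub>E UNIV)"
    and space: "function_space D F"
    and projection: "\<And>j. j \<in> {1..s} \<Longrightarrow> projection_on F (P j)"
    and commute: "\<And>i j f. i \<in> {1..s} \<Longrightarrow> j \<in> {1..s} \<Longrightarrow> f \<in> F \<Longrightarrow> P i (P j f) = P j (P i f)"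
    and independent: "\<And>j f. j \<in> {1..s} \<Longrightarrow> f \<in> F \<Longrightarrow> depends_only_on D ({1..s} - {j}) (P j f)"
    and fixes_independent: "\<And>j f. j \<in> {1..s} \<Longrightarrow> f \<in> F \<Longrightarrow>
          depends_only_on D ({1..s} - {j}) f \<Longrightarrow> P j f = f"
    and prod_independent: "\<And>u f. u \<subseteq> {1..s} \<Longrightarrow> f \<in> F \<Longrightarrow>
          depends_only_on D ({1..s} - u) (op_prod P u f)"

text \<open>
  The summands are required to belong to \<open>F\<close> when regarded as functions on \<open>D\<close>. With summands
  outside \<open>F\<close> a separable \<open>f\<close> need not be annihilated by the product of the operators
  \<open>I - op_prod P ({1..s} - u j)\<close>: on \<open>\<real>\<^sup>2\<close> let \<open>F\<close> be spanned by \<open>1\<close> and \<open>x\<^sub>1 + x\<^sub>2\<close>, and let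
  \<open>P\<^sub>1 = P\<^sub>2\<close> map \<open>1\<close> to \<open>1\<close> and \<open>x\<^sub>1 + x\<^sub>2\<close> to \<open>0\<close>.
\<close>

definition separable_in ::
    "(point \<Rightarrow> real) set \<Rightarrow> point set \<Rightarrow> nat \<Rightarrow> (nat \<Rightarrow> nat set) \<Rightarrow> (point \<Rightarrow> real) \<Rightarrow> bool" where
  "separable_in F D m u f \<longleftrightarrow>
     (\<exists>g :: nat \<Rightarrow> point \<Rightarrow> real.
        (\<forall>j\<in>{1..m}. (\<lambda>x. if x \<in> D then g j (restrict x (u j)) else 0) \<in> F) \<and>
        (\<forall>x\<in>D. f x = (\<Sum>j=1..m. g j (restrict x (u j)))))"

end

theory Submission
  imports Defs
begin

text \<open>
  Write \<open>Q\<^sub>j = P\<^bsub>-u\<^sub>j\<^esub>\<close>. Expanding the product factor by factor shows that \<open>f\<close> minus its image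
  is a sum of functions \<open>Q\<^sub>j h\<^sub>j\<close>, and \<open>Q\<^sub>j h\<^sub>j\<close> depends only on \<open>x\<^bsub>u\<^sub>j\<^esub>\<close>; so \<open>f\<close> is separable if
  its image vanishes. Conversely, the functions fixed by \<open>P\<^sub>i\<close> for every \<open>i \<notin> u\<^sub>j\<close> form a subspace
  that all the factors preserve, by commutativity, and that \<open>I - Q\<^sub>j\<close> annihilates; the \<open>j\<close>-th
  summand of a separable function lies in it.
\<close>

section \<open>Compositions of operators, additive operators and function spaces\<close>

lemma op_prod_closed:
  assumes "finite A" and "\<And>i g. i \<in> A \<Longrightarrow> g \<in> S \<Longrightarrow> Q i g \<in> S" and "f \<in> S"
  shows "op_prod Q A f \<in> S"
proof -
  have "foldr Q xs f \<in> S" if "set xs \<subseteq> A" for xs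
    using that assms(2,3) by (induction xs) auto
  then show ?thesis
    using assms(1) by (simp add: op_prod_def)
qed

lemma op_prod_fixed:
  assumes "finite A" and "\<And>i. i \<in> A \<Longrightarrow> Q i f = f"
  shows "op_prod Q A f = f"
  \<comment> \<open>A common fixed point is an invariant set with one element.\<close>
  using op_prod_closed[of A "{f}" Q f] assms by auto

text \<open>Collects properties that pass both to compositions and to complements
  \<open>I - Q\<close>, so they reach every operator in the product.\<close>

definition additive_on ::
    "('a \<Rightarrow> 'b::ab_group_add) set \<Rightarrow> (('a \<Rightarrow> 'b) \<Rightarrow> ('a \<Rightarrow> 'b)) \<Rightarrow> bool" where
  "additive_on F Q \<longleftrightarrow>
     (\<forall>f\<in>F. Q f \<in> F) \<and> (\<forall>f\<in>F. \<forall>g\<in>F. Q (\<lambda>x. f x + g x) = (\<lambda>x. Q f x + Q g x))"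

lemma additive_on_closed: "additive_on F Q \<Longrightarrow> f \<in> F \<Longrightarrow> Q f \<in> F"
  by (simp add: additive_on_def)

lemma additive_on_add:
  "additive_on F Q \<Longrightarrow> f \<in> F \<Longrightarrow> g \<in> F \<Longrightarrow> Q (\<lambda>x. f x + g x) = (\<lambda>x. Q f x + Q g x)"
  by (simp add: additive_on_def)

lemma additive_on_zero:
  assumes "additive_on F Q" and "(\<lambda>x. 0) \<in> F"
  shows "Q (\<lambda>x. 0) = (\<lambda>x. 0)"
proof
  fix x
  have "Q (\<lambda>x. 0) = (\<lambda>x. Q (\<lambda>x. 0) x + Q (\<lambda>x. 0) x)"
    using additive_on_add[OF assms(1,2,2)] by simp
  from fun_cong[OF this, of x] show "Q (\<lambda>x. 0) x = 0"
    by simp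
qed

lemma additive_on_foldr:
  assumes "\<And>i. i \<in> set xs \<Longrightarrow> additive_on F (Q i)"
  shows "additive_on F (foldr Q xs)"
  using assms by (induction xs) (auto simp: additive_on_def)

lemma additive_on_op_prod:
  assumes "finite A" and "\<And>i. i \<in> A \<Longrightarrow> additive_on F (Q i)"
  shows "additive_on F (op_prod Q A)"
  unfolding op_prod_def using assms by (intro additive_on_foldr) simp

lemma function_space_zero: "function_space D F \<Longrightarrow> (\<lambda>x. 0) \<in> F"
  by (simp add: function_space_def)

lemma function_space_add:
  "function_space D F \<Longrightarrow> f \<in> F \<Longrightarrow> g \<in> F \<Longrightarrow> (\<lambda>x. f x + g x) \<in> F"
  by (simp add: function_space_def)

lemma function_space_diff:
  assumes "function_space D F" and "f \<in> F" and "g \<in> F"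
  shows "(\<lambda>x. f x - g x) \<in> F"
proof -
  have "(\<lambda>x. - 1 * g x) \<in> F"
    using assms(1,3) unfolding function_space_def by blast
  from function_space_add[OF assms(1,2) this] show ?thesis
    by simp
qed

lemma function_space_sum:
  assumes "function_space D F" and "finite A" and "\<And>j. j \<in> A \<Longrightarrow> f j \<in> F"
  shows "(\<lambda>x. \<Sum>j\<in>A. f j x) \<in> F"
  using assms(2,3)
  by (induction A rule: finite_induct)
    (auto intro: function_space_zero[OF assms(1)] function_space_add[OF assms(1)])

lemma additive_on_sum:
  assumes "function_space D F" and "additive_on F Q"
    and "finite A" and "\<And>j. j \<in> A \<Longrightarrow> f j \<in> F"
  shows "Q (\<lambda>x. \<Sum>j\<in>A. f j x) = (\<lambda>x. \<Sum>j\<in>A. Q (f j) x)"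
  using assms(3,4)
proof (induction A rule: finite_induct)
  case empty
  then show ?case
    using additive_on_zero[OF assms(2) function_space_zero[OF assms(1)]] by simp
next
  case (insert a A)
  have "(\<lambda>x. \<Sum>j\<in>A. f j x) \<in> F"
    using insert by (intro function_space_sum[OF assms(1)]) auto
  then show ?case
    using insert additive_on_add[OF assms(2), of "f a" "\<lambda>x. \<Sum>j\<in>A. f j x"] by simp
qed

section \<open>Complements \<open>I - Q\<close> and their products\<close>

lemma additive_on_complement:
  assumes "function_space D F" and "additive_on F Q"
  shows "additive_on F (\<lambda>h x. h x - Q h x)"
  using assms(2) function_space_diff[OF assms(1)] by (auto simp: additive_on_def)

text \<open>Putting one more factor \<open>I - Q j\<close> in front replaces the current image
  \<open>r\<close> by \<open>r - Q j r\<close>, so only the term \<open>Q j r\<close> has to be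
  added to the sum.\<close>

lemma foldr_complement_telescope:
  fixes Q :: "'i \<Rightarrow> (point \<Rightarrow> real) \<Rightarrow> (point \<Rightarrow> real)"
  assumes "function_space D F" and "\<And>j. j \<in> set js \<Longrightarrow> additive_on F (Q j)"
    and "distinct js" and "f \<in> F"
  shows "\<exists>h. (\<forall>j\<in>set js. h j \<in> F) \<and>
    f = (\<lambda>x. foldr (\<lambda>j h x. h x - Q j h x) js f x + (\<Sum>j\<in>set js. Q j (h j) x))"
  using assms(2,3)
proof (induction js)
  case Nil
  then show ?case by simp
next
  case (Cons j js)
  let ?T = "\<lambda>j h x. h x - Q j h x"
  from Cons obtain h where h: "\<forall>i\<in>set js. h i \<in> F"
    "f = (\<lambda>x. foldr ?T js f x + (\<Sum>i\<in>set js. Q i (h i) x))"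
    by auto
  \<comment> \<open>The new summand comes from the image of \<open>f\<close> before the outermost
    factor acts.\<close>
  let ?h = "h(j := foldr ?T js f)"
  have "additive_on F (foldr ?T js)"
    by (rule additive_on_foldr, rule additive_on_complement[OF assms(1)]) (simp add: Cons.prems)
  then have mem: "foldr ?T js f \<in> F"
    using additive_on_closed assms(4) by blast
  \<comment> \<open>Since the list is distinct, updating \<open>h\<close> at \<open>j\<close> leaves
    the earlier summands unchanged.\<close>
  have sum: "(\<Sum>i\<in>set js. Q i (?h i) x) = (\<Sum>i\<in>set js. Q i (h i) x)" for x
    using Cons.prems(2) by (intro sum.cong) auto
  have "f x = foldr ?T (j # js) f x + (\<Sum>i\<in>set (j # js). Q i (?h i) x)" for x
    using fun_cong[OF h(2), of x] Cons.prems(2) sum[of x] by simp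
  then have "f = (\<lambda>x. foldr ?T (j # js) f x + (\<Sum>i\<in>set (j # js). Q i (?h i) x))"
    by (rule ext)
  moreover have "\<forall>i\<in>set (j # js). ?h i \<in> F"
    using h(1) mem by simp
  ultimately show ?case
    by blast
qed

section \<open>Separability as a decomposition within the function space\<close>

lemma depends_only_onE:
  assumes "depends_only_on D v f"
  obtains g where "\<And>x. x \<in> D \<Longrightarrow> f x = g (restrict x v)"
proof
  \<comment> \<open>A representative in \<open>D\<close> of each subvector; its value matters only
    at subvectors of points of \<open>D\<close>.\<close>
  let ?p = "\<lambda>y. SOME z. z \<in> D \<and> restrict z v = y"
  fix x assume "x \<in> D"
  then have "?p (restrict x v) \<in> D \<and> restrict (?p (restrict x v)) v = restrict x v"
    by (intro someI[of "\<lambda>z. z \<in> D \<and> restrict z v = restrict x v"]) simp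
  then show "f x = (\<lambda>y. f (?p y)) (restrict x v)"
    using assms \<open>x \<in> D\<close> unfolding depends_only_on_def by metis
qed

text \<open>Replaces functions of subvectors by their zero extensions from \<open>D\<close>, which
  are members of \<open>F\<close> to which the operators can be applied. Outside \<open>D\<close>
  both sides of the decomposition vanish.\<close>

lemma separable_in_iff:
  assumes "function_space D F" and "f \<in> F"
  shows "separable_in F D m u f \<longleftrightarrow>
    (\<exists>q. (\<forall>j\<in>{1..m}. q j \<in> F \<and> depends_only_on D (u j) (q j)) \<and> f = (\<lambda>x. \<Sum>j=1..m. q j x))"
    (is "?lhs \<longleftrightarrow> ?rhs")
proof
  have supp: "h x = 0" if "h \<in> F" "x \<notin> D" for h x
    using assms(1) that by (auto simp: function_space_def)
  {
    assume ?lhs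
    then obtain g where g: "\<forall>j\<in>{1..m}. (\<lambda>x. if x \<in> D then g j (restrict x (u j)) else 0) \<in> F"
      "\<forall>x\<in>D. f x = (\<Sum>j=1..m. g j (restrict x (u j)))"
      unfolding separable_in_def by blast
    have "f = (\<lambda>x. \<Sum>j=1..m. if x \<in> D then g j (restrict x (u j)) else 0)"
    proof
      fix x
      show "f x = (\<Sum>j=1..m. if x \<in> D then g j (restrict x (u j)) else 0)"
        using g(2) supp[OF assms(2)] by (cases "x \<in> D") auto
    qed
    then show ?rhs
      using g(1) by (intro exI[of _ "\<lambda>j x. if x \<in> D then g j (restrict x (u j)) else 0"])
        (simp add: depends_only_on_def)
  }
  {
    assume ?rhs
    then obtain q where q: "\<And>j. j \<in> {1..m} \<Longrightarrow> q j \<in> F"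
        "\<And>j. j \<in> {1..m} \<Longrightarrow> depends_only_on D (u j) (q j)"
        "f = (\<lambda>x. \<Sum>j=1..m. q j x)"
      by blast
    have "\<forall>j\<in>{1..m}. \<exists>g. \<forall>x\<in>D. q j x = g (restrict x (u j))"
      using q(2) depends_only_onE by metis
    then obtain g where g: "\<And>j x. j \<in> {1..m} \<Longrightarrow> x \<in> D \<Longrightarrow> q j x = g j (restrict x (u j))"
      by metis
    have "(\<lambda>x. if x \<in> D then g j (restrict x (u j)) else 0) = q j" if "j \<in> {1..m}" for j
      using g[OF that] supp[OF q(1)[OF that]] by auto
    then show ?lhs
      unfolding separable_in_def using q(1,3) g by (intro exI[of _ g]) auto
  }
qed

section \<open>Subspaces fixed by projections, and the criterion\<close>

context commuting_projections
begin

lemma additive_on_P: "j \<in> {1..s} \<Longrightarrow> additive_on F (P j)"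
  using projection by (simp add: projection_on_def additive_on_def)

lemma additive_on_op_prod_P: "v \<subseteq> {1..s} \<Longrightarrow> additive_on F (op_prod P v)"
  using additive_on_P by (intro additive_on_op_prod) (auto intro: finite_subset)

text \<open>For \<open>v \<subseteq> {1..s}\<close> these are the members of \<open>F\<close> that
  depend only on the coordinates outside \<open>v\<close>, described by operators so that
  commutativity applies directly.\<close>

definition fixed_space :: "nat set \<Rightarrow> (point \<Rightarrow> real) set" where
  "fixed_space v = {h \<in> F. \<forall>i\<in>v. P i h = h}"

lemma fixed_space_P:
  assumes "v \<subseteq> {1..s}" and "k \<in> {1..s}" and "h \<in> fixed_space v"
  shows "P k h \<in> fixed_space v"
proof -
  have h: "h \<in> F" "\<And>i. i \<in> v \<Longrightarrow> P i h = h"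
    using assms(3) by (auto simp: fixed_space_def)
  have "P i (P k h) = P k h" if "i \<in> v" for i
    using commute[of i k h] that assms(1,2) h by auto
  then show ?thesis
    using additive_on_closed[OF additive_on_P[OF assms(2)] h(1)] by (simp add: fixed_space_def)
qed

lemma fixed_space_op_prod:
  assumes "v \<subseteq> {1..s}" and "w \<subseteq> {1..s}" and "h \<in> fixed_space v"
  shows "op_prod P w h \<in> fixed_space v"
  using assms fixed_space_P by (intro op_prod_closed) (auto intro: finite_subset)

lemma fixed_space_diff:
  assumes "v \<subseteq> {1..s}" and "g \<in> fixed_space v" and "h \<in> fixed_space v"
  shows "(\<lambda>x. g x - h x) \<in> fixed_space v"
proof -
  have F: "g \<in> F" "h \<in> F" "(\<lambda>x. g x - h x) \<in> F"
    using assms function_space_diff[OF space] by (auto simp: fixed_space_def)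
  have "P i (\<lambda>x. g x - h x) = (\<lambda>x. g x - h x)" if "i \<in> v" for i
  proof
    fix x
    have "additive_on F (P i)"
      using that assms(1) additive_on_P by auto
    \<comment> \<open>Additivity is applied to \<open>g = (g - h) + h\<close>.\<close>
    from additive_on_add[OF this F(3,2)]
    have "P i g = (\<lambda>x. P i (\<lambda>x. g x - h x) x + P i h x)"
      by simp
    then have "P i g x = P i (\<lambda>x. g x - h x) x + P i h x"
      by (rule fun_cong)
    moreover have "P i g = g" "P i h = h"
      using that assms(2,3) by (simp_all add: fixed_space_def)
    ultimately show "P i (\<lambda>x. g x - h x) x = g x - h x"
      by simp
  qed
  with F(3) show ?thesis
    by (simp add: fixed_space_def)
qed

text \<open>Dependence on \<open>v\<close> alone implies independence of each single coordinate
  outside \<open>v\<close>, which is what \<open>fixes_independent\<close> asks for.\<close>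

lemma depends_only_on_fixed_space:
  assumes "v \<subseteq> {1..s}" and "h \<in> F" and "depends_only_on D v h"
  shows "h \<in> fixed_space ({1..s} - v)"
proof -
  have "P i h = h" if "i \<in> {1..s} - v" for i
  proof (rule fixes_independent)
    have "restrict x v = restrict y v"
      if "restrict x ({1..s} - {i}) = restrict y ({1..s} - {i})" for x y :: point
    proof -
      have "v \<subseteq> {1..s} - {i}"
        using assms(1) \<open>i \<in> {1..s} - v\<close> by auto
      then show ?thesis
        using that by (metis restrict_restrict inf.absorb2)
    qed
    then show "depends_only_on D ({1..s} - {i}) h"
      using assms(3) unfolding depends_only_on_def by blast
  qed (use that assms in auto)
  with assms(2) show ?thesis
    by (simp add: fixed_space_def)
qed

text \<open>Split the list at \<open>j\<close>: the factors to its right act first and stay in the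
  fixed space, the factor at \<open>j\<close> then gives zero, and the additive factors to its left
  keep zero.\<close>

lemma foldr_complement_fixed_space:
  assumes "\<And>i. i \<in> set js \<Longrightarrow> w i \<subseteq> {1..s}" and "j \<in> set js" and "h \<in> fixed_space (w j)"
  shows "foldr (\<lambda>i h x. h x - op_prod P (w i) h x) js h = (\<lambda>x. 0)"
proof -
  let ?T = "\<lambda>i h x. h x - op_prod P (w i) h x"
  obtain xs ys where js: "js = xs @ j # ys"
    using assms(2) by (auto dest: split_list)
  have wj: "w j \<subseteq> {1..s}"
    using assms(1,2) by blast
  have "foldr ?T zs h \<in> fixed_space (w j)" if "set zs \<subseteq> set js" for zs
    using that
  proof (induction zs)
    case Nil
    then show ?case using assms(3) by simp
  next
    case (Cons i zs)
    then have "w i \<subseteq> {1..s}" "foldr ?T zs h \<in> fixed_space (w j)"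
      using assms(1) by auto
    then show ?case
      using fixed_space_diff[OF wj] fixed_space_op_prod[OF wj] by simp
  qed
  from this[of ys] have "foldr ?T ys h \<in> fixed_space (w j)"
    using js by auto
  then have "op_prod P (w j) (foldr ?T ys h) = foldr ?T ys h"
    using wj by (intro op_prod_fixed) (auto simp: fixed_space_def intro: finite_subset)
  then have "?T j (foldr ?T ys h) = (\<lambda>x. 0)"
    by simp
  moreover have "additive_on F (foldr ?T xs)"
    by (rule additive_on_foldr, rule additive_on_complement[OF space], rule additive_on_op_prod_P)
      (use assms(1) js in auto)
  ultimately show ?thesis
    using additive_on_zero[OF _ function_space_zero[OF space]] by (simp add: js)
qed

theorem separable_iff_op_prod_eq_0:
  assumes "\<And>j. j \<in> {1..m} \<Longrightarrow> u j \<subseteq> {1..s}" and "f \<in> F"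
  shows "separable_in F D m u f \<longleftrightarrow>
    op_prod (\<lambda>j h x. h x - op_prod P ({1..s} - u j) h x) {1..m} f = (\<lambda>x. 0)"
    (is "_ \<longleftrightarrow> op_prod ?T _ f = _")
proof
  define js where "js = sorted_list_of_set {1..m}"
  have js: "set js = {1..m}" "distinct js"
    by (simp_all add: js_def)
  have op_prod_eq: "op_prod ?T {1..m} = foldr ?T js"
    by (simp add: op_prod_def js_def)
  {
    assume "separable_in F D m u f"
    then obtain q where q: "\<And>j. j \<in> {1..m} \<Longrightarrow> q j \<in> F"
        "\<And>j. j \<in> {1..m} \<Longrightarrow> depends_only_on D (u j) (q j)"
        "f = (\<lambda>x. \<Sum>j=1..m. q j x)"
      unfolding separable_in_iff[OF space assms(2)] by blast
    have "foldr ?T js (q j) = (\<lambda>x. 0)" if "j \<in> {1..m}" for j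
      by (rule foldr_complement_fixed_space[where j = j])
        (use that js q depends_only_on_fixed_space[OF assms(1)] in auto)
    \<comment> \<open>Additivity reduces the claim for \<open>f\<close> to its summands, each
      annihilated by the whole product.\<close>
    moreover have "additive_on F (foldr ?T js)"
      by (rule additive_on_foldr, rule additive_on_complement[OF space],
          rule additive_on_op_prod_P) auto
    ultimately show "op_prod ?T {1..m} f = (\<lambda>x. 0)"
      unfolding op_prod_eq q(3) using q(1) by (subst additive_on_sum[OF space]) auto
  }
  {
    assume zero: "op_prod ?T {1..m} f = (\<lambda>x. 0)"
    let ?Q = "\<lambda>j. op_prod P ({1..s} - u j)"
    have additive: "additive_on F (?Q j)" for j
      by (rule additive_on_op_prod_P) auto
    from foldr_complement_telescope[where Q = ?Q, OF space additive js(2) assms(2)]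
    obtain h where h': "\<forall>j\<in>{1..m}. h j \<in> F"
        "f = (\<lambda>x. foldr ?T js f x + (\<Sum>j=1..m. ?Q j (h j) x))"
      unfolding js(1) by blast
    \<comment> \<open>With zero image, the telescoped identity leaves only the sum.\<close>
    have h: "\<forall>j\<in>{1..m}. h j \<in> F" "f = (\<lambda>x. \<Sum>j=1..m. ?Q j (h j) x)"
      using h' zero[unfolded op_prod_eq] by simp_all
    have "depends_only_on D (u j) (?Q j (h j))" if "j \<in> {1..m}" for j
    proof -
      \<comment> \<open>\<open>prod_independent\<close> speaks of the complement of the projected
        coordinates, here a double complement.\<close>
      have "{1..s} - ({1..s} - u j) = u j"
        using assms(1)[OF that] by auto
      then show ?thesis
        using prod_independent[of "{1..s} - u j" "h j"] h(1) that by simp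
    qed
    then show "separable_in F D m u f"
      unfolding separable_in_iff[OF space assms(2)]
      using h additive_on_closed[OF additive] by (intro exI[of _ "\<lambda>j. ?Q j (h j)"]) auto
  }
qed

end

theorem theorem1:
  fixes m s :: nat
    and u :: "nat \<Rightarrow> nat set"
    and D :: "point set"
    and F :: "(point \<Rightarrow> real) set"
    and P :: "nat \<Rightarrow> (point \<Rightarrow> real) \<Rightarrow> (point \<Rightarrow> real)"
    and f :: "point \<Rightarrow> real"
  assumes "1 \<le> m" and "m \<le> s"
    and "\<And>j. j \<in> {1..m} \<Longrightarrow> u j \<noteq> {}"
    and "disjoint_family_on u {1..m}"
    and "(\<Union>j\<in>{1..m}. u j) = {1..s}"
    and "commuting_projections s D F P"
    and "f \<in> F"
  shows "separable_in F D m u f \<longleftrightarrow>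
    op_prod (\<lambda>j h x. h x - op_prod P ({1..s} - u j) h x) {1..m} f = (\<lambda>x. 0)"
  \<comment> \<open>The union condition yields \<open>u j \<subseteq> {1..s}\<close>.\<close>
  using commuting_projections.separable_iff_op_prod_eq_0[OF assms(6) _ assms(7)] assms(5) by blast

end
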